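(* Let $(X,\mathcal{A})$ be a measurable space, let $\mu:\mathcal{A}\to[0,\infty]$ be a measure, and let $S(X,\mathcal{A})$ be a $\chi$-ring containing every real constant function. Then $S(X,\mathcal{A})$ is connected in the $u_\mu$-topology if and only if $S(X,\mathcal{A})\subseteq L^\infty(X,\mathcal{A},\mu)$.
   Context: A measurable space $(X,\mathcal{A})$ is a nonempty set $X$ with a $\sigma$-algebra $\mathcal{A}$ of subsets of $X$. A measure is a countably additive map $\mu:\mathcal{A}\to[0,\infty]$ with $\mu(\emptyset)=0$. $\mathcal{M}(X,\mathcal{A})$ is the commutative ring (pointwise operations) of all $\mathcal{A}$-measurable functions $X\to\mathbb{R}$. A $\chi$-ring $S(X,\mathcal{A})$ is a subring of $\mathcal{M}(X,\mathcal{A})$ such that the characteristic function $\chi_A\in S(X,\mathcal{A})$ for every $A\in\mathcal{A}$. Let $\mathcal{A}_0=\{A\in\mathcal{A}:\mu(A)=0\}$. For $f\in S(X,\mathcal{A})$, $\epsilon>0$ in $\mathbb{R}$ and $E_0\in\mathcal{A}_0$, put $u(f,\epsilon,E_0)=\{g\in S(X,\mathcal{A}):\sup_{x\in X\setminus E_0}|f(x)-g(x)|<\epsilon\}$. The $u_\mu$-topology on $S(X,\mathcal{A})$ is the topology having as an open base the family $\{u(f,\epsilon,E_0): f\in S(X,\mathcal{A}),\ \epsilon>0,\ E_0\in\mathcal{A}_0\}$. $L^\infty(X,\mathcal{A},\mu)$ is the set of all $f\in\mathcal{M}(X,\mathcal{A})$ for which there exist $\lambda>0$ and $E\in\mathcal{A}_0$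 with $|f(x)|\le\lambda$ for all $x\in X\setminus E$ (functions, not equivalence classes).
   Formalization: The basic open sets are the unions of u(f,ε,E₀) over all null sets E₀, not the separate u(f,ε,E₀); with separate sets E₀=∅ gives plain uniform convergence on X, and the claim fails for X=ℕ, μ=0, S all functions. *)

theory Defs
  imports "HOL-Analysis.Analysis" "HOL-Algebra.Subrings"
begin

text \<open>
  A measure space in HOL is a measure on a \<open>\<sigma>\<close>-algebra over the subset \<open>space M\<close> of a type.
  A real function on \<open>space M\<close> is represented by its extension that is \<open>undefined\<close> outside
  \<open>space M\<close>, so that HOL equality coincides with equality of functions on \<open>space M\<close>.
\<close>

definition measurable_fun :: "'a measure \<Rightarrow> ('a \<Rightarrow> real) set" where
  "measurable_fun M = borel_measurable M \<inter> extensional (space M)"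

definition measurable_ring :: "'a measure \<Rightarrow> ('a \<Rightarrow> real) ring" where
  "measurable_ring M =
     \<lparr>carrier = measurable_fun M,
      mult = (\<lambda>f g. \<lambda>x\<in>space M. f x * g x),
      one = (\<lambda>x\<in>space M. 1),
      zero = (\<lambda>x\<in>space M. 0),
      add = (\<lambda>f g. \<lambda>x\<in>space M. f x + g x)\<rparr>"

definition chi_ring :: "'a measure \<Rightarrow> ('a \<Rightarrow> real) set \<Rightarrow> bool" where
  "chi_ring M S \<longleftrightarrow>
     subring S (measurable_ring M) \<and>
     (\<forall>A\<in>sets M. restrict (indicat_real A) (space M) \<in> S)"

definition Linf :: "'a measure \<Rightarrow> ('a \<Rightarrow> real) set" where
  "Linf M =
     {f \<in> measurable_fun M.
        \<exists>c>0. \<exists>E\<in>null_sets M. \<forall>x\<in>space M - E. \<bar>f x\<bar> \<le> c}"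

text \<open>
  The supremum is taken in the extended reals: it is \<open>\<infinity>\<close> for an unbounded difference and
  \<open>-\<infinity>\<close> over the empty set (the case \<open>E0 = space M\<close> of a null measure).
\<close>

definition u_set ::
  "'a measure \<Rightarrow> ('a \<Rightarrow> real) set \<Rightarrow> ('a \<Rightarrow> real) \<Rightarrow> real \<Rightarrow> 'a set \<Rightarrow> ('a \<Rightarrow> real) set" where
  "u_set M S f e E0 =
     {g \<in> S. (SUP x\<in>space M - E0. ereal \<bar>f x - g x\<bar>) < ereal e}"

text \<open>
  Two functions are close if they are uniformly close off some null set, which may depend on
  both of them: the exceptional set \<open>E0\<close> is existentially quantified inside a basic open set.
  Taking each \<open>u_set M S f e E0\<close> with its own fixed \<open>E0\<close> as a basic open set would not
  involve the measure at all: since \<open>{}\<close> is a null set and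
  \<open>u_set M S f e {} \<subseteq> u_set M S f e E0\<close>, that family is a base of the topology of uniform
  convergence on the whole of \<open>space M\<close>, in which \<open>Linf M\<close> is disconnected as soon as it contains
  an unbounded function.
\<close>

definition u_nbhd ::
  "'a measure \<Rightarrow> ('a \<Rightarrow> real) set \<Rightarrow> ('a \<Rightarrow> real) \<Rightarrow> real \<Rightarrow> ('a \<Rightarrow> real) set" where
  "u_nbhd M S f e = (\<Union>E0\<in>null_sets M. u_set M S f e E0)"

definition u_base :: "'a measure \<Rightarrow> ('a \<Rightarrow> real) set \<Rightarrow> ('a \<Rightarrow> real) set set" where
  "u_base M S = {u_nbhd M S f e |f e. f \<in> S \<and> e > 0}"

definition u_topology :: "'a measure \<Rightarrow> ('a \<Rightarrow> real) set \<Rightarrow> ('a \<Rightarrow> real) topology" where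
  "u_topology M S = topology (arbitrary union_of (\<lambda>U. U \<in> u_base M S))"


lemma measurable_ring_simps:
  "carrier (measurable_ring M) = measurable_fun M"
  "f \<otimes>\<^bsub>measurable_ring M\<^esub> g = (\<lambda>x\<in>space M. f x * g x)"
  "\<one>\<^bsub>measurable_ring M\<^esub> = (\<lambda>x\<in>space M. 1)"
  "\<zero>\<^bsub>measurable_ring M\<^esub> = (\<lambda>x\<in>space M. 0)"
  "f \<oplus>\<^bsub>measurable_ring M\<^esub> g = (\<lambda>x\<in>space M. f x + g x)"
  by (simp_all add: measurable_ring_def)

lemma restrict_measurable_fun:
  "f \<in> borel_measurable M \<Longrightarrow> restrict f (space M) \<in> measurable_fun M"
  unfolding measurable_fun_def by (auto cong: measurable_cong)

lemma cring_measurable_ring: "cring (measurable_ring M)"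
proof (rule cringI)
  note [simp] = measurable_ring_simps
  have meas: "f \<in> borel_measurable M" if "f \<in> measurable_fun M" for f
    using that by (simp add: measurable_fun_def)
  have restr: "restrict f (space M) = f" if "f \<in> measurable_fun M" for f
    using that by (simp add: measurable_fun_def extensional_restrict)
  have closed: "(\<lambda>x\<in>space M. f x + g x) \<in> measurable_fun M"
    "(\<lambda>x\<in>space M. f x * g x) \<in> measurable_fun M"
    "(\<lambda>x\<in>space M. - f x) \<in> measurable_fun M"
    if "f \<in> measurable_fun M" "g \<in> measurable_fun M" for f g
    using meas[OF that(1)] meas[OF that(2)]
    by (intro restrict_measurable_fun; measurable)+
  have const: "(\<lambda>x\<in>space M. c) \<in> measurable_fun M" for c :: real
    by (rule restrict_measurable_fun) simp
  show "abelian_group (measurable_ring M)"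
  proof (rule abelian_groupI)
    fix f assume f: "f \<in> carrier (measurable_ring M)"
    show "\<exists>g\<in>carrier (measurable_ring M).
        g \<oplus>\<^bsub>measurable_ring M\<^esub> f = \<zero>\<^bsub>measurable_ring M\<^esub>"
      using f closed(3)[of f f]
      by (intro bexI[where x="\<lambda>x\<in>space M. - f x"]) (simp_all cong: restrict_cong)
  qed (simp_all add: closed const restr add_ac cong: restrict_cong)
  show "comm_monoid (measurable_ring M)"
    by (rule comm_monoidI) (simp_all add: closed const restr mult_ac cong: restrict_cong)
qed (simp add: measurable_ring_simps distrib_right cong: restrict_cong)


lemma mem_u_set:
  "g \<in> u_set M S f e E \<longleftrightarrow>
     g \<in> S \<and> (\<exists>r<e. \<forall>x\<in>space M - E. \<bar>f x - g x\<bar> \<le> r)"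
proof -
  have "(SUP x\<in>space M - E. ereal \<bar>f x - g x\<bar>) < ereal e \<longleftrightarrow>
      (\<exists>r<e. \<forall>x\<in>space M - E. \<bar>f x - g x\<bar> \<le> r)" (is "?s < _ \<longleftrightarrow> ?R")
  proof
    assume "?s < ereal e"
    then obtain r where "?s < ereal r" "ereal r < ereal e"
      using ereal_dense2 by blast
    have "\<bar>f x - g x\<bar> \<le> r" if "x \<in> space M - E" for x
      using SUP_lessD[OF \<open>?s < ereal r\<close> that] by simp
    with \<open>ereal r < ereal e\<close> show ?R by auto
  next
    assume ?R
    then obtain r where "r < e" "\<forall>x\<in>space M - E. \<bar>f x - g x\<bar> \<le> r" by blast
    then have "?s \<le> ereal r" by (intro SUP_least) auto
    with \<open>r < e\<close> show "?s < ereal e"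
      by (meson ereal_less_eq(3) le_less_trans less_ereal.simps(1))
  qed
  then show ?thesis by (simp add: u_set_def)
qed

lemma u_nbhd_refl: "f \<in> S \<Longrightarrow> e > 0 \<Longrightarrow> f \<in> u_nbhd M S f e"
  by (auto simp: u_nbhd_def mem_u_set intro!: bexI[of _ "{}"])

lemma u_nbhd_subset:
  assumes "h \<in> u_nbhd M S f e"
  shows "\<exists>d>0. \<forall>d'\<le>d. u_nbhd M S h d' \<subseteq> u_nbhd M S f e"
proof -
  obtain E r where E: "E \<in> null_sets M" and r: "r < e"
    and b: "\<forall>x\<in>space M - E. \<bar>f x - h x\<bar> \<le> r"
    using assms by (auto simp: u_nbhd_def mem_u_set)
  have "u_nbhd M S h d' \<subseteq> u_nbhd M S f e" if d': "d' \<le> e - r" for d'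
  proof
    fix k assume "k \<in> u_nbhd M S h d'"
    then obtain F s where F: "F \<in> null_sets M" and s: "s < d'" and k: "k \<in> S"
      and c: "\<forall>x\<in>space M - F. \<bar>h x - k x\<bar> \<le> s"
      by (auto simp: u_nbhd_def mem_u_set)
    have "\<bar>f x - k x\<bar> \<le> r + s" if "x \<in> space M - (E \<union> F)" for x
    proof -
      have "\<bar>f x - h x\<bar> \<le> r" "\<bar>h x - k x\<bar> \<le> s" using b c that by auto
      then show ?thesis by linarith
    qed
    moreover have "r + s < e" using s d' by linarith
    ultimately have "k \<in> u_set M S f e (E \<union> F)"
      using k unfolding mem_u_set by blast
    then show "k \<in> u_nbhd M S f e"
      using E F by (auto simp: u_nbhd_def)
  qed
  then show ?thesis using r by (intro exI[of _ "e - r"]) auto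
qed

lemma istopology_u_base: "istopology (arbitrary union_of (\<lambda>U. U \<in> u_base M S))"
  unfolding istopology_base_eq
proof (intro allI impI)
  fix U V assume UV: "U \<in> u_base M S \<and> V \<in> u_base M S"
  show "(arbitrary union_of (\<lambda>U. U \<in> u_base M S)) (U \<inter> V)"
    unfolding arbitrary_union_of_alt
  proof
    fix h assume h: "h \<in> U \<inter> V"
    from UV obtain f e g d where U: "U = u_nbhd M S f e" and V: "V = u_nbhd M S g d"
      by (auto simp: u_base_def)
    from h U have hS: "h \<in> S" by (auto simp: u_nbhd_def u_set_def)
    obtain a where a: "a > 0" "\<forall>d'\<le>a. u_nbhd M S h d' \<subseteq> U"
      using u_nbhd_subset[of h M S f e] h U by auto
    obtain b where b: "b > 0" "\<forall>d'\<le>b. u_nbhd M S h d' \<subseteq> V"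
      using u_nbhd_subset[of h M S g d] h V by auto
    have "u_nbhd M S h (min a b) \<subseteq> U \<inter> V"
      using a b by simp
    moreover have "u_nbhd M S h (min a b) \<in> u_base M S"
      using hS a b unfolding u_base_def by (auto intro!: exI[of _ h] exI[of _ "min a b"])
    ultimately show "\<exists>W. W \<in> u_base M S \<and> h \<in> W \<and> W \<subseteq> U \<inter> V"
      using u_nbhd_refl[OF hS, of "min a b" M] a(1) b(1) by (metis min_less_iff_conj)
  qed
qed

lemma openin_u_topology:
  "openin (u_topology M S) = arbitrary union_of (\<lambda>U. U \<in> u_base M S)"
  unfolding u_topology_def by (rule topology_inverse'[OF istopology_u_base])

lemma topspace_u_topology: "topspace (u_topology M S) = S"
proof
  show "topspace (u_topology M S) \<subseteq> S"
    unfolding topspace_def openin_u_topology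
    by (force simp: union_of_def arbitrary_def u_base_def u_nbhd_def u_set_def)
  show "S \<subseteq> topspace (u_topology M S)"
  proof
    fix f assume f: "f \<in> S"
    have "openin (u_topology M S) (u_nbhd M S f 1)"
      unfolding openin_u_topology using f
      by (intro arbitrary_union_of_inc) (force simp: u_base_def)
    then show "f \<in> topspace (u_topology M S)"
      using u_nbhd_refl[OF f, of 1 M] openin_subset by fastforce
  qed
qed

end

theory Submission
  imports Defs
begin

text \<open>
  A function at finite essential distance from an essentially bounded one is itself essentially
  bounded, so \<open>S \<inter> Linf M\<close> is open and closed in \<open>S\<close>, and it contains the constant \<open>0\<close>.
  Conversely, if all members of \<open>S\<close> are essentially bounded, then any two of them are joined by
  the segment \<open>t \<mapsto> (1 - t) f + t g\<close>, which stays in \<open>S\<close> because \<open>S\<close> contains the constants,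
  and which is Lipschitz since \<open>f - g\<close> is essentially bounded.
\<close>

lemma mem_u_nbhd:
  "g \<in> u_nbhd M S f e \<longleftrightarrow>
     g \<in> S \<and> (\<exists>E\<in>null_sets M. \<exists>r<e. \<forall>x\<in>space M - E. \<bar>f x - g x\<bar> \<le> r)"
  by (auto simp: u_nbhd_def mem_u_set)

text \<open>By \<open>u_nbhd_subset\<close>, a basic set contains a smaller one centred at any of
  its points, so openness can be tested with sets centred at the point itself, as in a metric
  space.\<close>

lemma openin_u_topology_iff:
  "openin (u_topology M S) U \<longleftrightarrow> U \<subseteq> S \<and> (\<forall>f\<in>U. \<exists>e>0. u_nbhd M S f e \<subseteq> U)"
proof
  assume op: "openin (u_topology M S) U"
  have "\<exists>e>0. u_nbhd M S f e \<subseteq> U" if "f \<in> U" for f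
  proof -
    obtain W where "W \<in> u_base M S" "f \<in> W" "W \<subseteq> U"
      using op \<open>f \<in> U\<close> unfolding openin_u_topology arbitrary_union_of_alt by blast
    then show ?thesis
      using u_nbhd_subset unfolding u_base_def by fast
  qed
  then show "U \<subseteq> S \<and> (\<forall>f\<in>U. \<exists>e>0. u_nbhd M S f e \<subseteq> U)"
    using openin_subset[OF op] by (simp add: topspace_u_topology)
next
  assume U: "U \<subseteq> S \<and> (\<forall>f\<in>U. \<exists>e>0. u_nbhd M S f e \<subseteq> U)"
  show "openin (u_topology M S) U"
    unfolding openin_u_topology arbitrary_union_of_alt
  proof
    fix f assume "f \<in> U"
    then obtain e where "e > 0" "u_nbhd M S f e \<subseteq> U" "f \<in> S"
      using U by blast
    then show "\<exists>W. W \<in> u_base M S \<and> f \<in> W \<and> W \<subseteq> U"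
      unfolding u_base_def using u_nbhd_refl by blast
  qed
qed

lemma Linf_if_bounded_difference:
  assumes f: "f \<in> Linf M" and g: "g \<in> measurable_fun M"
    and E: "E \<in> null_sets M" and diff: "\<forall>x\<in>space M - E. \<bar>f x - g x\<bar> \<le> r"
  shows "g \<in> Linf M"
proof -
  obtain c F where "c > 0" and F: "F \<in> null_sets M" and c: "\<forall>x\<in>space M - F. \<bar>f x\<bar> \<le> c"
    using f by (auto simp: Linf_def)
  \<comment> \<open>\<open>r\<close> may be negative when \<open>E\<close> is all of
    \<open>space M\<close>; its absolute value keeps the new bound positive, as \<open>Linf\<close>
    demands.\<close>
  have "\<bar>g x\<bar> \<le> c + \<bar>r\<bar>" if "x \<in> space M - (E \<union> F)" for x
  proof -
    have "\<bar>f x - g x\<bar> \<le> r" "\<bar>f x\<bar> \<le> c" using diff c that by auto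
    then show ?thesis by linarith
  qed
  moreover have "c + \<bar>r\<bar> > 0" using \<open>c > 0\<close> by simp
  ultimately show ?thesis
    using g null_sets.Un[OF E F] unfolding Linf_def by blast
qed

text \<open>The radius 1 serves at every point, since a finite distance off a null set already
  preserves essential boundedness.\<close>

lemma openin_u_topology_Int_Linf:
  assumes "S \<subseteq> measurable_fun M"
  shows "openin (u_topology M S) (S \<inter> Linf M)"
  unfolding openin_u_topology_iff
proof (intro conjI ballI)
  fix f assume f: "f \<in> S \<inter> Linf M"
  have "u_nbhd M S f 1 \<subseteq> S \<inter> Linf M"
  proof
    fix g assume g: "g \<in> u_nbhd M S f 1"
    then obtain E r where "E \<in> null_sets M" "\<forall>x\<in>space M - E. \<bar>f x - g x\<bar> \<le> r"
      by (auto simp: mem_u_nbhd)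
    moreover have "g \<in> S"
      using g by (simp add: mem_u_nbhd)
    ultimately show "g \<in> S \<inter> Linf M"
      using f assms Linf_if_bounded_difference[of f M g E r] by blast
  qed
  then show "\<exists>e>0. u_nbhd M S f e \<subseteq> S \<inter> Linf M"
    by (intro exI[of _ 1]) simp
qed simp

lemma closedin_u_topology_Int_Linf:
  assumes "S \<subseteq> measurable_fun M"
  shows "closedin (u_topology M S) (S \<inter> Linf M)"
  unfolding closedin_def topspace_u_topology openin_u_topology_iff
proof (intro conjI ballI)
  fix f assume f: "f \<in> S - S \<inter> Linf M"
  have "u_nbhd M S f 1 \<subseteq> S - S \<inter> Linf M"
  proof
    fix g assume g: "g \<in> u_nbhd M S f 1"
    \<comment> \<open>The difference is reversed so that \<open>g\<close> takes the role of the
      bounded function: if \<open>g\<close> were in \<open>Linf M\<close>, so would be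
      \<open>f\<close>.\<close>
    then obtain E r where "E \<in> null_sets M" "\<forall>x\<in>space M - E. \<bar>g x - f x\<bar> \<le> r"
      by (auto simp: mem_u_nbhd abs_minus_commute)
    then have "g \<notin> Linf M"
      using f assms Linf_if_bounded_difference[of g M f E r] by blast
    then show "g \<in> S - S \<inter> Linf M"
      using g by (simp add: mem_u_nbhd)
  qed
  then show "\<exists>e>0. u_nbhd M S f e \<subseteq> S - S \<inter> Linf M"
    by (intro exI[of _ 1]) simp
qed auto

lemma pathin_segment:
  fixes M :: "'a measure" and f g :: "'a \<Rightarrow> real"
  defines "p \<equiv> \<lambda>t. \<lambda>x\<in>space M. (1 - t) * f x + t * g x"
  assumes p: "\<And>t. p t \<in> S" and f: "f \<in> Linf M" and g: "g \<in> Linf M"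
  shows "pathin (u_topology M S) p"
proof -
  obtain c E where "c > 0" and E: "E \<in> null_sets M" and c: "\<forall>x\<in>space M - E. \<bar>f x\<bar> \<le> c"
    using f by (auto simp: Linf_def)
  obtain d F where "d > 0" and F: "F \<in> null_sets M" and d: "\<forall>x\<in>space M - F. \<bar>g x\<bar> \<le> d"
    using g by (auto simp: Linf_def)
  \<comment> \<open>The exceptional set \<open>E \<union> F\<close> depends on neither parameter, so
    one constant \<open>c + d\<close> bounds the speed of the whole segment.\<close>
  have lipschitz: "\<bar>p s x - p t x\<bar> \<le> \<bar>t - s\<bar> * (c + d)" if "x \<in> space M - (E \<union> F)" for s t x
  proof -
    have "\<bar>f x\<bar> \<le> c" "\<bar>g x\<bar> \<le> d" using c d that by auto
    then have "\<bar>f x - g x\<bar> \<le> c + d" by linarith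
    moreover have "p s x - p t x = (t - s) * (f x - g x)"
      using that by (simp add: p_def algebra_simps)
    ultimately show ?thesis
      by (simp add: abs_mult mult_left_mono)
  qed
  \<comment> \<open>The strict bound demanded by \<open>u_nbhd\<close> is witnessed by
    \<open>\<bar>t - s\<bar> * (c + d)\<close>, which is below \<open>e\<close>.\<close>
  have near: "p t \<in> u_nbhd M S (p s) e" if "dist t s < e / (c + d)" for s t e
  proof -
    have "\<bar>t - s\<bar> * (c + d) < e"
      using that \<open>c > 0\<close> \<open>d > 0\<close> by (simp add: dist_real_def pos_less_divide_eq)
    then show ?thesis
      unfolding mem_u_nbhd using p lipschitz null_sets.Un[OF E F] by blast
  qed
  show ?thesis
    unfolding pathin_def continuous_map
  proof (intro conjI allI impI)
    show "p ` topspace (top_of_set {0..1}) \<subseteq> topspace (u_topology M S)"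
      using p by (auto simp: topspace_u_topology)
  next
    fix U assume U: "openin (u_topology M S) U"
    show "openin (top_of_set {0..1}) {t \<in> topspace (top_of_set {0..1}). p t \<in> U}"
      unfolding openin_euclidean_subtopology_iff
    proof (intro conjI ballI)
      fix s assume s: "s \<in> {t \<in> topspace (top_of_set {0..1}). p t \<in> U}"
      then obtain e where "e > 0" "u_nbhd M S (p s) e \<subseteq> U"
        using U unfolding openin_u_topology_iff by blast
      then show "\<exists>\<delta>>0. \<forall>t\<in>{0..1}. dist t s < \<delta> \<longrightarrow> t \<in> {t \<in> topspace (top_of_set {0..1}). p t \<in> U}"
        using near \<open>c > 0\<close> \<open>d > 0\<close> by (intro exI[of _ "e / (c + d)"]) auto
    qed auto
  qed
qed

text \<open>A subring need not be closed under real scalars; with the constants as members, scaling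
  becomes multiplication in the ring.\<close>

lemma subring_measurable_ring_segment:
  assumes S: "subring S (measurable_ring M)" and const: "\<And>c :: real. (\<lambda>x\<in>space M. c) \<in> S"
    and f: "f \<in> S" and g: "g \<in> S"
  shows "(\<lambda>x\<in>space M. (1 - t) * f x + t * g x) \<in> S"
proof -
  have scale: "(\<lambda>x\<in>space M. c * h x) \<in> S" if "h \<in> S" for c h
    using subringE(6)[OF S const that, of c]
    by (simp add: measurable_ring_simps cong: restrict_cong)
  show ?thesis
    using subringE(7)[OF S scale[OF f] scale[OF g], of "1 - t" t]
    by (simp add: measurable_ring_simps cong: restrict_cong)
qed

theorem corollary5p4:
  fixes M :: "'a measure" and S :: "('a \<Rightarrow> real) set"
  assumes "space M \<noteq> {}"
    and "chi_ring M S"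
    and "\<And>c :: real. (\<lambda>x\<in>space M. c) \<in> S"
  shows "connected_space (u_topology M S) \<longleftrightarrow> S \<subseteq> Linf M"
proof -
  have subring: "subring S (measurable_ring M)"
    using assms(2) by (simp add: chi_ring_def)
  have meas: "S \<subseteq> measurable_fun M"
    using subringE(1)[OF subring] by (simp add: measurable_ring_simps)
  show ?thesis
  proof
    assume "connected_space (u_topology M S)"
    then have "S \<inter> Linf M = {} \<or> S \<inter> Linf M = S"
      using openin_u_topology_Int_Linf[OF meas] closedin_u_topology_Int_Linf[OF meas]
      unfolding connected_space_clopen_in topspace_u_topology by blast
    \<comment> \<open>This rules out the empty alternative. The bound 1 is chosen because
      \<open>Linf\<close> asks for a positive one.\<close>
    moreover have "(\<lambda>x\<in>space M. 0) \<in> S \<inter> Linf M"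
      using assms(3)[of 0] meas by (auto simp: Linf_def intro!: exI[of _ 1] bexI[of _ "{}"])
    ultimately show "S \<subseteq> Linf M" by blast
  next
    assume bounded: "S \<subseteq> Linf M"
    have "path_connected_space (u_topology M S)"
      unfolding path_connected_space_def topspace_u_topology
    proof (intro ballI)
      fix f g assume f: "f \<in> S" and g: "g \<in> S"
      define p where "p = (\<lambda>t. \<lambda>x\<in>space M. (1 - t) * f x + t * g x)"
      have "pathin (u_topology M S) p"
        unfolding p_def using f g bounded
        by (intro pathin_segment subring_measurable_ring_segment[OF subring assms(3)]) auto
      \<comment> \<open>The endpoints are equal as HOL functions because members of \<open>S\<close>
        are extensional, so restricting them to \<open>space M\<close> changes nothing.\<close>
      moreover have "p 0 = f" "p 1 = g"
        using f g meas
        by (auto simp: p_def measurable_fun_def extensional_restrict cong: restrict_cong)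
      ultimately show "\<exists>p. pathin (u_topology M S) p \<and> p 0 = f \<and> p 1 = g" by blast
    qed
    then show "connected_space (u_topology M S)"
      by (rule path_connected_imp_connected_space)
  qed
qed

end
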